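(* Let $N\in\mathbb{N}$ and $\widetilde{L}>0$. Let $f:\mathbb{R}^d\to\mathbb{R}$ be a $1$-weakly convex function with $\widetilde{L}$-bounded subgradients, and suppose $f$ has a global minimizer $x_\star$. Let $R>0$, and let $x_0\in\mathbb{R}^d$ satisfy $$f(y_0)-f(x_\star)+\|x_0-y_0\|^2\le R^2,\qquad\text{where } y_0=\mathbf{prox}_{(1/2)f}(x_0).$$ Let $h\in\mathbb{R}$ and consider the iterates $$x_{k+1}=x_k-h f'(x_k),\qquad k=0,1,\dots,N,$$ where $f'(x_k)\in\partial f(x_k)$ is an arbitrary subgradient of $f$ at $x_k$. For $k=0,1,\dots,N+1$ let $$y_k=\mathbf{prox}_{(1/2)f}(x_k),\qquad f'(y_k)=2(x_k-y_k),\qquad \psi_k=b_k\left(f(y_k)-f(x_\star)+\|x_k-y_k\|^2\right).$$ If $h\in(0,1/2]$, and the real numbers $b_0,\dots,b_{N+1}$ and $c_0,\dots,c_N$ satisfy $b_{N+1}=0$, $4+(1-2h)b_{k+1}=b_k$ for $k=0,\dots,N$, and $c_k=h^2 b_{k+1}$ for $k=0,\dots,N$, then $$\|f'(y_k)\|^2+\psi_{k+1}-\psi_k\le c_k\|f'(x_k)\|^2\qquad\text{for all } k=0,1,\dots,N,$$ and $$\frac{1}{N+1}\sum_{i=0}^{N}\|\nabla f_{(1/2)}(x_i)\|^2\le\frac{1}{N+1}\left(\widetilde{L}^2\sum_{i=0}^{N}c_i+b_0R^2\right).$$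
   Context: $\mathbb{R}^d$ carries the standard inner product and Euclidean norm $\|\cdot\|$. A function $f:\mathbb{R}^d\to\mathbb{R}$ is $1$-weakly convex if $f+\frac12\|\cdot\|^2$ is convex. The subdifferential $\partial f$ is an abstract subdifferential: it equals the usual convex subdifferential when $f$ is convex, equals $\{\nabla f(x)\}$ at points $x$ where $f$ is continuously differentiable, contains $0$ at local minimizers, and satisfies $\partial\left(f(\cdot)+\frac{\beta}{2}\|\cdot-y\|^2\right)=\partial f(\cdot)+\beta(\cdot-y)$ for all $y\in\mathbb{R}^d$, $\beta\in\mathbb{R}$. In particular, for $1$-weakly convex $f$, $g\in\partial f(x)$ if and only if $f(z)\ge f(x)+\langle g\mid z-x\rangle-\frac12\|z-x\|^2$ for all $z\in\mathbb{R}^d$. The function $f$ has $\widetilde{L}$-bounded subgradients if $\|g\|\le\widetilde{L}$ for all $x\in\mathbb{R}^d$ and $g\in\partial f(x)$. For $1$-weakly convex $f$, the proximal operator and Moreau envelope (with parameter $\hat\rho=2$) are $$\mathbf{prox}_{(1/2)f}(x)=\mathrm{argmin}_{y\in\mathbb{R}^d}\left\{f(y)+\|y-x\|^2\right\},\qquad f_{(1/2)}(x)=\min_{y\in\mathbb{R}^d}\left\{f(y)+\|y-x\|^2\right\}.$$ The minimizer exists and is unique, $f_{(1/2)}$ is continuously differentiable, and with $y=\mathbf{prox}_{(1/2)f}(x)$ one has $\nabla f_{(1/2)}(x)=2(x-y)\in\partial f(y)$. *)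

theory Defs
  imports "HOL-Analysis.Analysis"
begin

definition weakly_convex :: "real \<Rightarrow> ('a::real_inner \<Rightarrow> real) \<Rightarrow> bool" where
  "weakly_convex \<rho> f \<longleftrightarrow> convex_on UNIV (\<lambda>x. f x + \<rho> / 2 * (norm x)\<^sup>2)"

definition convex_subdifferential :: "('a::real_inner \<Rightarrow> real) \<Rightarrow> 'a \<Rightarrow> 'a set" where
  "convex_subdifferential f x = {g. \<forall>z. f z \<ge> f x + g \<bullet> (z - x)}"

(* The function g is the gradient of f near x, and is continuous there. *)
definition C1_near :: "('a::real_inner \<Rightarrow> real) \<Rightarrow> ('a \<Rightarrow> 'a) \<Rightarrow> 'a \<Rightarrow> bool" where
  "C1_near f g x \<longleftrightarrow>
     (\<exists>S. open S \<and> x \<in> S \<and> (\<forall>z\<in>S. GDERIV f z :> g z) \<and> continuous_on S g)"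

(* An operator f, x \<mapsto> sd f x on all real functions, specified only by the four usual rules.
   The rules are consistent: the Frechet subdifferential satisfies them. *)
definition abstract_subdifferential ::
  "(('a::real_inner \<Rightarrow> real) \<Rightarrow> 'a \<Rightarrow> 'a set) \<Rightarrow> bool" where
  "abstract_subdifferential sd \<longleftrightarrow>
     (\<forall>f x. convex_on UNIV f \<longrightarrow> sd f x = convex_subdifferential f x) \<and>
     (\<forall>f g x. C1_near f g x \<longrightarrow> sd f x = {g x}) \<and>
     (\<forall>f x. (\<forall>\<^sub>F z in nhds x. f x \<le> f z) \<longrightarrow> 0 \<in> sd f x) \<and>
     (\<forall>f \<beta> y x. sd (\<lambda>z. f z + \<beta> / 2 * (norm (z - y))\<^sup>2) x = (\<lambda>g. g + \<beta> *\<^sub>R (x - y)) ` sd f x)"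

definition bounded_subgradients ::
  "(('a::real_inner \<Rightarrow> real) \<Rightarrow> 'a \<Rightarrow> 'a set) \<Rightarrow> real \<Rightarrow> ('a \<Rightarrow> real) \<Rightarrow> bool" where
  "bounded_subgradients sd L f \<longleftrightarrow> (\<forall>x. \<forall>g\<in>sd f x. norm g \<le> L)"

(* Parameter 1/2: the proximity term norm (y - x)^2 / (2 * (1/2)) is just norm (y - x)^2. *)
definition prox_half :: "('a::real_inner \<Rightarrow> real) \<Rightarrow> 'a \<Rightarrow> 'a" where
  "prox_half f x = arg_min (\<lambda>y. f y + (norm (y - x))\<^sup>2) (\<lambda>_. True)"

(* On a Euclidean space, for weakly convex f bounded below, the infimum is a minimum. *)
definition moreau_half :: "('a::real_inner \<Rightarrow> real) \<Rightarrow> 'a \<Rightarrow> real" where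
  "moreau_half f x = (INF y. f y + (norm (y - x))\<^sup>2)"

definition gradient :: "('a::real_inner \<Rightarrow> real) \<Rightarrow> 'a \<Rightarrow> 'a" where
  "gradient f x = (THE g. GDERIV f x :> g)"

end

theory Submission
  imports Defs
begin

text \<open>
  Comparing the prox objective at \<open>x\<^sub>k\<^sub>+\<^sub>1\<close> with its value at \<open>y\<^sub>k\<close> gives a recursion for the envelope gap
  \<open>D\<^sub>k = f y\<^sub>k - f x\<^sub>\<star> + \<parallel>x\<^sub>k - y\<^sub>k\<parallel>\<^sup>2\<close> with the cross term \<open>-2 h \<langle>f' x\<^sub>k, x\<^sub>k - y\<^sub>k\<rangle>\<close>. The subgradient
  inequality at \<open>x\<^sub>k\<close> loses \<open>\<parallel>x\<^sub>k - y\<^sub>k\<parallel>\<^sup>2 / 2\<close>, while the \<open>1\<close>-strong convexity of the prox objective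
  gains it back, so the cross term is at most \<open>-2 h \<parallel>x\<^sub>k - y\<^sub>k\<parallel>\<^sup>2\<close>. What remains is
  \<open>(2 h b\<^sub>k\<^sub>+\<^sub>1 - 4) (f y\<^sub>k - f x\<^sub>\<star>)\<close>, which is nonpositive because the backward recursion for \<open>b\<close>
  increases from \<open>0\<close> towards its fixed point \<open>2 / h\<close>.
\<close>

section \<open>Weak convexity along segments\<close>

lemma norm_sq_convex_combination:
  fixes u v :: "'a::real_inner"
  shows "(norm ((1 - t) *\<^sub>R u + t *\<^sub>R v))\<^sup>2
    = (1 - t) * (norm u)\<^sup>2 + t * (norm v)\<^sup>2 - t * (1 - t) * (norm (v - u))\<^sup>2"
  unfolding power2_norm_eq_inner inner_simps inner_commute[of v u] by algebra

lemma weakly_convexD: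
  assumes "weakly_convex \<rho> f" and "0 \<le> t" "t \<le> 1"
  shows "f ((1 - t) *\<^sub>R u + t *\<^sub>R v)
    \<le> (1 - t) * f u + t * f v + \<rho> / 2 * t * (1 - t) * (norm (v - u))\<^sup>2"
proof -
  have "f ((1 - t) *\<^sub>R u + t *\<^sub>R v) + \<rho> / 2 * (norm ((1 - t) *\<^sub>R u + t *\<^sub>R v))\<^sup>2
      \<le> (1 - t) * (f u + \<rho> / 2 * (norm u)\<^sup>2) + t * (f v + \<rho> / 2 * (norm v)\<^sup>2)"
    using assms convex_onD[of UNIV _ t u v] unfolding weakly_convex_def by blast
  then show ?thesis
    unfolding norm_sq_convex_combination
    by (simp add: algebra_simps add_divide_distrib diff_divide_distrib)
qed

lemma weakly_convex_continuous:
  fixes f :: "'a::euclidean_space \<Rightarrow> real"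
  assumes "weakly_convex \<rho> f"
  shows "continuous_on UNIV f"
proof -
  have "continuous_on UNIV (\<lambda>x. f x + \<rho> / 2 * (norm x)\<^sup>2)"
    using assms unfolding weakly_convex_def by (intro convex_on_continuous open_UNIV)
  then have "continuous_on UNIV (\<lambda>x. (f x + \<rho> / 2 * (norm x)\<^sup>2) - \<rho> / 2 * (norm x)\<^sup>2)"
    by (rule continuous_on_diff) (intro continuous_intros)
  then show ?thesis by simp
qed

section \<open>The proximal point\<close>

lemma prox_half_minimal:
  fixes f :: "'a::euclidean_space \<Rightarrow> real"
  assumes cont: "continuous_on UNIV f" and lb: "\<And>z. m \<le> f z"
  shows "f (prox_half f x) + (norm (prox_half f x - x))\<^sup>2 \<le> f z + (norm (z - x))\<^sup>2"
proof -
  let ?\<phi> = "\<lambda>y. f y + (norm (y - x))\<^sup>2"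
  \<comment> \<open>Outside this ball the squared distance alone exceeds \<open>f x - m\<close>, so
    the objective exceeds \<open>f x\<close>, its value at the center. A minimizer over the compact
    ball is therefore global.\<close>
  let ?r = "sqrt (f x - m)"
  have "continuous_on (cball x ?r) ?\<phi>"
    by (intro continuous_on_add continuous_on_subset[OF cont] subset_UNIV continuous_intros)
  moreover have "cball x ?r \<noteq> {}"
    using lb[of x] by simp
  ultimately obtain p where p: "\<And>y. y \<in> cball x ?r \<Longrightarrow> ?\<phi> p \<le> ?\<phi> y"
    using continuous_attains_inf[OF compact_cball, of x ?r ?\<phi>] by blast
  have "?\<phi> p \<le> ?\<phi> y" for y
  proof (cases "y \<in> cball x ?r")
    case False
    then have "?r < norm (y - x)"
      by (simp add: dist_norm norm_minus_commute)
    then have "?r\<^sup>2 < (norm (y - x))\<^sup>2"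
      by (rule power_strict_mono) (use lb[of x] in auto)
    then have "f x - m < (norm (y - x))\<^sup>2"
      using lb[of x] by simp
    moreover have "?\<phi> p \<le> f x"
      using p[of x] lb[of x] by simp
    ultimately show ?thesis using lb[of y] by linarith
  qed (use p in blast)
  then have "is_arg_min ?\<phi> (\<lambda>_. True) p"
    by (auto simp: is_arg_min_def not_less)
  then have "is_arg_min ?\<phi> (\<lambda>_. True) (prox_half f x)"
    unfolding prox_half_def arg_min_def by (rule someI)
  then show ?thesis by (auto simp: is_arg_min_def not_less)
qed

text \<open>The objective is 1-strongly convex: the squared distance has modulus 2, and weak
  convexity costs 1. Minimality is tested at a point \<open>w\<close> between the prox point and
  \<open>z\<close>; dividing by \<open>t\<close> leaves a factor \<open>1 - t\<close> on the growth
  term.\<close>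

lemma prox_half_strong_minimum:
  fixes f :: "'a::euclidean_space \<Rightarrow> real"
  assumes wc: "weakly_convex 1 f" and lb: "\<And>z. m \<le> f z"
  shows "f (prox_half f x) + (norm (prox_half f x - x))\<^sup>2 + 1 / 2 * (norm (z - prox_half f x))\<^sup>2
    \<le> f z + (norm (z - x))\<^sup>2"
proof -
  let ?p = "prox_half f x" and ?\<phi> = "\<lambda>y. f y + (norm (y - x))\<^sup>2"
  \<comment> \<open>With \<open>s = 1 - t\<close>, a bound for all \<open>s\<close> in (0,1) stands
    in for the limit \<open>t\<close> to 0.\<close>
  have "s * (1 / 2 * (norm (z - ?p))\<^sup>2) \<le> ?\<phi> z - ?\<phi> ?p" if s: "0 < s" "s < 1" for s
  proof -
    define t where "t = 1 - s"
    define w where "w = (1 - t) *\<^sub>R ?p + t *\<^sub>R z"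
    have t: "0 < t" "t < 1" using s by (auto simp: t_def)
    have w: "w - x = (1 - t) *\<^sub>R (?p - x) + t *\<^sub>R (z - x)"
      by (simp add: w_def algebra_simps)
    have "?\<phi> ?p \<le> ?\<phi> w"
      by (rule prox_half_minimal[OF weakly_convex_continuous[OF wc] lb])
    also have "\<dots> \<le> (1 - t) * ?\<phi> ?p + t * ?\<phi> z - 1 / 2 * t * (1 - t) * (norm (z - ?p))\<^sup>2"
      using weakly_convexD[OF wc, of t ?p z] t
      unfolding w norm_sq_convex_combination
      by (simp add: w_def algebra_simps add_divide_distrib diff_divide_distrib)
    finally have "t * (s * (1 / 2 * (norm (z - ?p))\<^sup>2)) \<le> t * (?\<phi> z - ?\<phi> ?p)"
      by (simp add: t_def algebra_simps)
    then show ?thesis using t by simp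
  qed
  then show ?thesis
    using field_le_mult_one_interval[of "1 / 2 * (norm (z - ?p))\<^sup>2" "?\<phi> z - ?\<phi> ?p"] by simp
qed

section \<open>The Moreau envelope and its gradient\<close>

lemma moreau_half_le:
  assumes lb: "\<And>z. m \<le> f z"
  shows "moreau_half f x \<le> f y + (norm (y - x))\<^sup>2"
  unfolding moreau_half_def
proof (rule cINF_lower)
  show "bdd_below (range (\<lambda>y. f y + (norm (y - x))\<^sup>2))"
    by (rule bdd_belowI2[of _ m]) (use lb in \<open>simp add: add_increasing2\<close>)
qed simp

lemma moreau_half_eq:
  fixes f :: "'a::euclidean_space \<Rightarrow> real"
  assumes "continuous_on UNIV f" and "\<And>z. m \<le> f z"
  shows "moreau_half f x = f (prox_half f x) + (norm (prox_half f x - x))\<^sup>2"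
  using moreau_half_le[where m = m, OF assms(2)] prox_half_minimal[OF assms]
  unfolding moreau_half_def by (intro antisym cINF_greatest) auto

text \<open>Each bound tests the objective centered at one point with the prox point of the other.
  The upper one is then direct; in the lower one the displacement of the prox point enters a cross
  term, which the quadratic growth at the strong minimum absorbs.\<close>

lemma moreau_half_quadratic_approx:
  fixes f :: "'a::euclidean_space \<Rightarrow> real"
  assumes wc: "weakly_convex 1 f" and lb: "\<And>z. m \<le> f z"
  shows "\<bar>moreau_half f z - moreau_half f x - (2 *\<^sub>R (x - prox_half f x)) \<bullet> (z - x)\<bar>
    \<le> (norm (z - x))\<^sup>2"
proof -
  let ?p = "prox_half f x" and ?q = "prox_half f z"
  note eq = moreau_half_eq[OF weakly_convex_continuous[OF wc] lb]
  have shift: "(norm (u - z))\<^sup>2 = (norm (u - x))\<^sup>2 - 2 * ((u - x) \<bullet> (z - x)) + (norm (z - x))\<^sup>2" for u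
    by (simp add: power2_norm_eq_inner inner_simps inner_commute)
  have "moreau_half f z \<le> f ?p + (norm (?p - z))\<^sup>2"
    by (rule moreau_half_le[OF lb])
  then have upper: "moreau_half f z - moreau_half f x - (2 *\<^sub>R (x - ?p)) \<bullet> (z - x)
      \<le> (norm (z - x))\<^sup>2"
    unfolding eq[of x] shift by (simp add: inner_simps algebra_simps)
  \<comment> \<open>The factor 2 makes the coefficient of \<open>(norm (?q - ?p))\<^sup>2\<close>
    after halving equal to the growth constant 1/2.\<close>
  have "0 \<le> (norm (?q - ?p - 2 *\<^sub>R (z - x)))\<^sup>2"
    by simp
  also have "\<dots> = (norm (?q - ?p))\<^sup>2 - 4 * ((?q - ?p) \<bullet> (z - x)) + 4 * (norm (z - x))\<^sup>2"
    by (simp add: power2_norm_eq_inner inner_simps inner_commute)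
  finally have young: "2 * ((?q - ?p) \<bullet> (z - x)) \<le> 1 / 2 * (norm (?q - ?p))\<^sup>2 + 2 * (norm (z - x))\<^sup>2"
    by simp
  have split: "(?q - x) \<bullet> (z - x) = (?q - ?p) \<bullet> (z - x) - (x - ?p) \<bullet> (z - x)"
    by (simp add: inner_simps)
  have "moreau_half f x + 1 / 2 * (norm (?q - ?p))\<^sup>2 \<le> f ?q + (norm (?q - x))\<^sup>2"
    unfolding eq by (rule prox_half_strong_minimum[OF wc lb])
  moreover have "moreau_half f z
      = f ?q + (norm (?q - x))\<^sup>2 - 2 * ((?q - x) \<bullet> (z - x)) + (norm (z - x))\<^sup>2"
    unfolding eq[of z] shift by simp
  ultimately have "- (norm (z - x))\<^sup>2
      \<le> moreau_half f z - moreau_half f x - (2 *\<^sub>R (x - ?p)) \<bullet> (z - x)"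
    using young split unfolding inner_scaleR_left by linarith
  with upper show ?thesis by linarith
qed

lemma GDERIV_of_quadratic_approx:
  fixes F :: "'a::real_inner \<Rightarrow> real"
  assumes "\<And>z. \<bar>F z - F x - g \<bullet> (z - x)\<bar> \<le> C * (norm (z - x))\<^sup>2"
  shows "GDERIV F x :> g"
  unfolding gderiv_def
proof (rule has_derivativeI)
  show "bounded_linear (\<lambda>h. h \<bullet> g)"
    by (rule bounded_linear_inner_left)
  have "((\<lambda>z. C * norm (z - x)) \<longlongrightarrow> C * norm (x - x)) (at x)"
    by (intro tendsto_intros)
  then have lim: "((\<lambda>z. C * norm (z - x)) \<longlongrightarrow> 0) (at x)"
    by simp
  have "norm ((F z - F x - (z - x) \<bullet> g) /\<^sub>R norm (z - x)) \<le> C * norm (z - x)" if "z \<noteq> x" for z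
    using assms[of z] that
    by (simp add: inner_commute divide_simps power2_eq_square mult.assoc)
  then show "((\<lambda>z. ((F z - F x) - (z - x) \<bullet> g) /\<^sub>R norm (z - x)) \<longlongrightarrow> 0) (at x)"
    by (intro Lim_null_comparison[OF _ lim]) (auto simp: eventually_at_filter)
qed

lemma gradient_eqI:
  assumes "GDERIV F x :> g"
  shows "gradient F x = g"
  unfolding gradient_def
proof (rule the_equality)
  show "GDERIV F x :> g" by (rule assms)
  fix g' assume "GDERIV F x :> g'"
  then have "(\<lambda>h. h \<bullet> g') = (\<lambda>h. h \<bullet> g)"
    using assms unfolding gderiv_def by (rule has_derivative_unique)
  then show "g' = g"
    by (metis inner_commute vector_eq_ldot)
qed

lemma gradient_moreau_half:
  fixes f :: "'a::euclidean_space \<Rightarrow> real"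
  assumes "weakly_convex 1 f" and "\<And>z. m \<le> f z"
  shows "gradient (moreau_half f) x = 2 *\<^sub>R (x - prox_half f x)"
  by (intro gradient_eqI GDERIV_of_quadratic_approx[where C = 1])
    (use moreau_half_quadratic_approx[OF assms] in simp)

section \<open>Subgradient inequalities, one-step descent and recursion bounds\<close>

lemma weakly_convex_subgradient_ineq:
  assumes sd: "abstract_subdifferential sd" and wc: "weakly_convex \<rho> f" and g: "g \<in> sd f x"
  shows "f z \<ge> f x + g \<bullet> (z - x) - \<rho> / 2 * (norm (z - x))\<^sup>2"
proof -
  \<comment> \<open>The shift by 0 matches the quadratic rule of the abstract subdifferential, which
    carries \<open>g\<close> to a subgradient of a convex function.\<close>
  let ?G = "\<lambda>z. f z + \<rho> / 2 * (norm (z - 0))\<^sup>2"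
  have "g + \<rho> *\<^sub>R (x - 0) \<in> sd ?G x"
    using sd g unfolding abstract_subdifferential_def by blast
  also have "sd ?G x = convex_subdifferential ?G x"
    using sd wc unfolding abstract_subdifferential_def weakly_convex_def by simp
  finally have "?G z \<ge> ?G x + (g + \<rho> *\<^sub>R (x - 0)) \<bullet> (z - x)"
    unfolding convex_subdifferential_def by blast
  then show ?thesis
    by (simp add: power2_norm_eq_inner inner_simps inner_commute algebra_simps)
qed

text \<open>Let d be the distance from \<open>x\<close> to its prox point. The strong minimum tested
  at \<open>x\<close> makes \<open>f\<close> drop by at least 3/2 d^2 from \<open>x\<close> to the
  prox point; the subgradient inequality gives back only 1/2 d^2.\<close>

lemma subgradient_inner_prox_ge:
  fixes f :: "'a::euclidean_space \<Rightarrow> real"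
  assumes "abstract_subdifferential sd" and wc: "weakly_convex 1 f" and lb: "\<And>z. m \<le> f z"
    and "g \<in> sd f x"
  shows "g \<bullet> (x - prox_half f x) \<ge> (norm (x - prox_half f x))\<^sup>2"
proof -
  let ?p = "prox_half f x"
  have "g \<bullet> (?p - x) = - (g \<bullet> (x - ?p))"
    by (simp add: inner_simps)
  with weakly_convex_subgradient_ineq[OF assms(1) wc assms(4), of ?p]
    prox_half_strong_minimum[OF wc lb, of x x]
  show ?thesis by (simp add: norm_minus_commute)
qed

lemma envelope_descent:
  fixes f :: "'a::euclidean_space \<Rightarrow> real"
  assumes sd: "abstract_subdifferential sd" and wc: "weakly_convex 1 f" and lb: "\<And>z. m \<le> f z"
    and g: "g \<in> sd f x" and h: "0 < h" and b: "0 \<le> b" "h * b \<le> 2"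
  defines "D \<equiv> \<lambda>x. f (prox_half f x) - m + (norm (x - prox_half f x))\<^sup>2"
  shows "(norm (2 *\<^sub>R (x - prox_half f x)))\<^sup>2 + b * D (x - h *\<^sub>R g) - (4 + (1 - 2 * h) * b) * D x
    \<le> h\<^sup>2 * b * (norm g)\<^sup>2"
proof -
  let ?y = "prox_half f x" and ?x' = "x - h *\<^sub>R g"
  define \<Delta> where "\<Delta> = f ?y - m"
  have Dx: "D x = \<Delta> + (norm (x - ?y))\<^sup>2"
    by (simp add: D_def \<Delta>_def)
  have "D ?x' \<le> \<Delta> + (norm (?x' - ?y))\<^sup>2"
    using prox_half_minimal[OF weakly_convex_continuous[OF wc] lb, of ?x' ?y]
    by (simp add: D_def \<Delta>_def norm_minus_commute)
  also have "(norm (?x' - ?y))\<^sup>2 = (norm (x - ?y))\<^sup>2 - 2 * h * (g \<bullet> (x - ?y)) + h\<^sup>2 * (norm g)\<^sup>2"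
    unfolding power2_norm_eq_inner inner_simps inner_commute[of x g] inner_commute[of ?y g] inner_commute[of ?y x]
    by algebra
  also have "\<dots> \<le> (norm (x - ?y))\<^sup>2 - 2 * h * (norm (x - ?y))\<^sup>2 + h\<^sup>2 * (norm g)\<^sup>2"
    using subgradient_inner_prox_ge[OF sd wc lb g] h by simp
  finally have "b * D ?x'
      \<le> b * (\<Delta> + (norm (x - ?y))\<^sup>2 - 2 * h * (norm (x - ?y))\<^sup>2 + h\<^sup>2 * (norm g)\<^sup>2)"
    using b by (simp add: mult_left_mono)
  \<comment> \<open>In the claim all multiples of \<open>(norm (x - ?y))\<^sup>2\<close> cancel,
    leaving \<open>(2 * h * b - 4) * \<Delta>\<close>, whose sign is settled here.\<close>
  moreover have "h * b * \<Delta> \<le> 2 * \<Delta>"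
    using b(2) by (rule mult_right_mono) (use lb[of ?y] in \<open>simp add: \<Delta>_def\<close>)
  ultimately show ?thesis
    unfolding Dx norm_scaleR power_mult_distrib by (simp add: algebra_simps)
qed

text \<open>By the recursion, \<open>h * b k\<close> is the average of 2 and
  \<open>h * b (Suc k)\<close> with weights \<open>2 * h\<close> and \<open>1 - 2 * h\<close>, both
  nonnegative since \<open>h \<le> 1 / 2\<close>; so it stays at most 2.\<close>

lemma backward_recursion_bounds:
  fixes b :: "nat \<Rightarrow> real"
  assumes h: "0 < h" "h \<le> 1 / 2" and last: "b n = 0"
    and rec: "\<And>k. k < n \<Longrightarrow> 4 + (1 - 2 * h) * b (Suc k) = b k"
    and "k \<le> n"
  shows "0 \<le> b k \<and> h * b k \<le> 2"
  using \<open>k \<le> n\<close>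
proof (induction k rule: inc_induct)
  case base
  then show ?case by (simp add: last)
next
  case (step k)
  have "(1 - 2 * h) * (h * b (Suc k)) \<le> (1 - 2 * h) * 2"
    using step.IH h by (intro mult_left_mono) auto
  moreover have "h * b k = 4 * h + (1 - 2 * h) * (h * b (Suc k))"
    by (simp add: rec[OF step.hyps(2), symmetric] algebra_simps)
  moreover have "0 \<le> (1 - 2 * h) * b (Suc k)"
    using step.IH h by simp
  ultimately show ?case
    using rec[OF step.hyps(2)] by simp
qed

theorem theorem1:
  fixes sd :: "((real ^ 'd \<Rightarrow> real) \<Rightarrow> real ^ 'd \<Rightarrow> (real ^ 'd) set)"
    and f :: "real ^ 'd \<Rightarrow> real"
    and xs :: "real ^ 'd"
    and x y f'x f'y :: "nat \<Rightarrow> real ^ 'd"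
    and \<psi> b c :: "nat \<Rightarrow> real"
    and L R h :: real
    and N :: nat
  assumes "abstract_subdifferential sd"
    and "L > 0"
    and "weakly_convex 1 f"
    and "bounded_subgradients sd L f"
    and "\<And>z. f xs \<le> f z"
    and "R > 0"
    and "f (y 0) - f xs + (norm (x 0 - y 0))\<^sup>2 \<le> R\<^sup>2"
    and "\<And>k. k \<le> N \<Longrightarrow> f'x k \<in> sd f (x k)"
    and "\<And>k. k \<le> N \<Longrightarrow> x (k + 1) = x k - h *\<^sub>R f'x k"
    and "\<And>k. k \<le> N + 1 \<Longrightarrow> y k = prox_half f (x k)"
    and "\<And>k. k \<le> N + 1 \<Longrightarrow> f'y k = 2 *\<^sub>R (x k - y k)"
    and "\<And>k. k \<le> N + 1 \<Longrightarrow> \<psi> k = b k * (f (y k) - f xs + (norm (x k - y k))\<^sup>2)"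
    and "h \<in> {0<..1/2}"
    and "b (N + 1) = 0"
    and "\<And>k. k \<le> N \<Longrightarrow> 4 + (1 - 2 * h) * b (k + 1) = b k"
    and "\<And>k. k \<le> N \<Longrightarrow> c k = h\<^sup>2 * b (k + 1)"
  shows "(\<forall>k\<le>N. (norm (f'y k))\<^sup>2 + \<psi> (k + 1) - \<psi> k \<le> c k * (norm (f'x k))\<^sup>2) \<and>
    1 / (real N + 1) * (\<Sum>i=0..N. (norm (gradient (moreau_half f) (x i)))\<^sup>2)
      \<le> 1 / (real N + 1) * (L\<^sup>2 * (\<Sum>i=0..N. c i) + b 0 * R\<^sup>2)"
proof -
  note wc = assms(3)
  have h: "0 < h" "h \<le> 1 / 2"
    using assms(13) by auto
  have b: "0 \<le> b k" "h * b k \<le> 2" if "k \<le> N + 1" for k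
    using backward_recursion_bounds[of h b "N + 1" k] h assms(14,15) that by auto
  have descent: "(norm (f'y k))\<^sup>2 + \<psi> (k + 1) - \<psi> k \<le> c k * (norm (f'x k))\<^sup>2" if k: "k \<le> N" for k
    using envelope_descent[OF assms(1) wc assms(5) assms(8)[OF k] h(1) b[of "k + 1"]] k
      assms(9)[OF k] assms(10)[of k] assms(10)[of "k + 1"] assms(11)[of k]
      assms(12)[of k] assms(12)[of "k + 1"] assms(15)[OF k] assms(16)[OF k]
    by simp
  have step: "(norm (f'y k))\<^sup>2 \<le> L\<^sup>2 * c k - (\<psi> (Suc k) - \<psi> k)" if k: "k \<le> N" for k
  proof -
    have "norm (f'x k) \<le> L"
      using assms(4) assms(8)[OF k] unfolding bounded_subgradients_def by blast
    then have "(norm (f'x k))\<^sup>2 \<le> L\<^sup>2"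
      by (simp add: power_mono)
    \<comment> \<open>The sign of \<open>c k\<close> allows the subgradient norm to be replaced by
      its bound \<open>L\<close>.\<close>
    moreover have "0 \<le> c k"
      using assms(16)[OF k] b[of "k + 1"] k by simp
    ultimately have "c k * (norm (f'x k))\<^sup>2 \<le> L\<^sup>2 * c k"
      by (metis mult.commute mult_left_mono)
    with descent[OF k] show ?thesis by simp
  qed
  have "gradient (moreau_half f) (x k) = f'y k" if "k \<le> N" for k
    using gradient_moreau_half[OF wc assms(5)] assms(10,11)[of k] that by simp
  then have "(\<Sum>i=0..N. (norm (gradient (moreau_half f) (x i)))\<^sup>2) = (\<Sum>i=0..N. (norm (f'y i))\<^sup>2)"
    by (intro sum.cong) auto
  also have "\<dots> \<le> (\<Sum>i=0..N. L\<^sup>2 * c i - (\<psi> (Suc i) - \<psi> i))"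
    by (intro sum_mono step) auto
  also have "\<dots> = L\<^sup>2 * (\<Sum>i=0..N. c i) - (\<psi> (Suc N) - \<psi> 0)"
    using sum_Suc_diff[of 0 N \<psi>] by (simp add: sum_subtractf sum_distrib_left)
  \<comment> \<open>After telescoping, \<open>b (N + 1) = 0\<close> kills the last potential, and
    \<open>b 0 \<ge> 0\<close> lets the initial gap bound \<open>R\<^sup>2\<close> control the
    first.\<close>
  also have "\<dots> \<le> L\<^sup>2 * (\<Sum>i=0..N. c i) + b 0 * R\<^sup>2"
    using assms(12)[of "N + 1"] assms(12)[of 0] assms(14) mult_left_mono[OF assms(7) b(1)[of 0]]
    by simp
  finally show ?thesis
    using descent by (intro conjI allI impI mult_left_mono) auto
qed

end
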